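(* There is an absolute constant $c_0>0$ such that the following holds. Let $r \geq 3$ and $d\ge 2$ be fixed integers, and let $n$ be a positive integer with $r \mid n$. Let $X(n,r)$ be the set of permutations in the symmetric group $S_n$ that consist of $\frac nr$ disjoint $r$-cycles. Choose $d$ permutations $\tau_1,\tau_2,\ldots,\tau_d$ uniformly at random and independently (with replacement) from $X(n,r)$, and let $H$ be the random hypergraph with vertex-set $S_n$ and edge-set $$\{\{\sigma,\sigma \tau_i, \sigma \tau_i^2,\ldots,\sigma \tau_i^{r-1}\}:\ \sigma \in S_n,\ i \in \{1,\ldots,d\}\}.$$ Then with high probability (that is, with probability tending to $1$ as $n\to\infty$ through multiples of $r$), $H$ is a linear, $r$-uniform, $d$-regular hypergraph with girth at least $$c_0 \left(\frac{n}{r(\log(d-1)+\log(r-1))}\right)^{1/3}.$$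
   Context: A hypergraph $H$ is a pair of finite sets $(V(H),E(H))$, where $E(H)$ (the edges) is a family of distinct subsets of $V(H)$ (the vertices). It is $r$-uniform if all its edges have size $r$, $d$-regular if each vertex is contained in exactly $d$ edges, and linear if any two distinct edges share at most one vertex. A hypergraph is a (Berge) cycle of length $l$ if it has exactly $l\ge 2$ edges and there is a cyclic ordering $(e_1,\ldots,e_l)$ of its (distinct) edges such that there exist distinct vertices $v_1,\ldots,v_l$ with $v_i\in e_i\cap e_{i+1}$ for all $i$, where $e_{l+1}:=e_1$. The girth of a hypergraph $H$ is the length of the shortest cycle it contains, i.e. the least $l$ such that some $l$ edges of $H$ form a cycle ($\infty$ if there is none). $\log$ denotes the natural logarithm. *)

theory Defs
  imports "HOL-Probability.Probability" "HOL-Combinatorics.Combinatorics"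
begin

type_synonym 'a hypergraph = "'a set \<times> 'a set set"

abbreviation verts :: "'a hypergraph \<Rightarrow> 'a set" where "verts \<equiv> fst"
abbreviation edges :: "'a hypergraph \<Rightarrow> 'a set set" where "edges \<equiv> snd"

definition hypergraph :: "'a hypergraph \<Rightarrow> bool" where
  "hypergraph H \<longleftrightarrow> finite (verts H) \<and> edges H \<subseteq> Pow (verts H)"

definition uniform :: "nat \<Rightarrow> 'a hypergraph \<Rightarrow> bool" where
  "uniform r H \<longleftrightarrow> (\<forall>e\<in>edges H. finite e \<and> card e = r)"

definition regular :: "nat \<Rightarrow> 'a hypergraph \<Rightarrow> bool" where
  "regular d H \<longleftrightarrow>
     (\<forall>v\<in>verts H. finite {e \<in> edges H. v \<in> e} \<and> card {e \<in> edges H. v \<in> e} = d)"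

definition linear_hypergraph :: "'a hypergraph \<Rightarrow> bool" where
  "linear_hypergraph H \<longleftrightarrow>
     (\<forall>e\<in>edges H. \<forall>f\<in>edges H. e \<noteq> f \<longrightarrow> finite (e \<inter> f) \<and> card (e \<inter> f) \<le> 1)"

definition berge_cycle :: "nat \<Rightarrow> 'a set set \<Rightarrow> bool" where
  "berge_cycle l C \<longleftrightarrow> l \<ge> 2 \<and>
     (\<exists>es vs. distinct es \<and> set es = C \<and> length es = l \<and>
              distinct vs \<and> length vs = l \<and>
              (\<forall>i<l. vs ! i \<in> es ! i \<inter> es ! (Suc i mod l)))"

text \<open>The infimum of the empty set in \<^typ>\<open>enat\<close> is \<open>\<infinity>\<close>, and a nonempty infimum is attained.\<close>

definition girth :: "'a hypergraph \<Rightarrow> enat" where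
  "girth H = Inf {enat l |l. \<exists>C\<subseteq>edges H. berge_cycle l C}"

definition perms_upto :: "nat \<Rightarrow> (nat \<Rightarrow> nat) set" where
  "perms_upto n = {p. p permutes {1..n}}"

text \<open>Permutations in \<open>S\<^sub>n\<close> that are products of \<open>n/r\<close> pairwise disjoint \<open>r\<close>-cycles; distinctness
  of \<open>concat cs\<close> says both that each list is a cycle and that the cycles are disjoint.\<close>

definition cyc_perms :: "nat \<Rightarrow> nat \<Rightarrow> (nat \<Rightarrow> nat) set" where
  "cyc_perms n r = {p \<in> perms_upto n. \<exists>cs.
     length cs = n div r \<and> (\<forall>c\<in>set cs. length c = r) \<and>
     distinct (concat cs) \<and> set (concat cs) \<subseteq> {1..n} \<and>
     p = foldr (\<circ>) (map cycle_of_list cs) id}"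

lemma finite_cyc_perms: "finite (cyc_perms n r)"
  by (simp add: cyc_perms_def perms_upto_def finite_permutations)

lemma cyc_perms_nonempty:
  assumes "r dvd n"
  shows "cyc_perms n r \<noteq> {}"
proof (cases "r = 0")
  case True
  then have "id \<in> cyc_perms n r"
    using assms by (auto simp: cyc_perms_def perms_upto_def intro!: exI[of _ "[]"])
  then show ?thesis by blast
next
  case False
  obtain m where n: "n = r * m" using assms by (elim dvdE)
  define cs where "cs = map (\<lambda>i. [r * i + 1..<r * i + r + 1]) [0..<m]"
  have concat_cs: "concat cs = [1..<n + 1]"
  proof -
    have "concat (map (\<lambda>i. [r * i + 1..<r * i + r + 1]) [0..<k]) = [1..<r * k + 1]" for k
    proof (induction k)
      case (Suc k)
      have "[1..<r * k + 1 + r] = [1..<r * k + 1] @ [r * k + 1..<r * k + 1 + r]"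
        by (rule upt_add_eq_append) simp
      then show ?case using Suc by (simp add: algebra_simps)
    qed simp
    then show ?thesis by (simp add: cs_def n)
  qed
  have permutes: "foldr (\<circ>) (map cycle_of_list xs) id permutes {1..n}"
    if "set (concat xs) \<subseteq> {1..n}" for xs
    using that
  proof (induction xs)
    case (Cons x xs)
    have x: "cycle_of_list x permutes {1..n}"
      by (rule permutes_subset[OF cycle_permutes]) (use Cons.prems in simp)
    have "foldr (\<circ>) (map cycle_of_list xs) id permutes {1..n}"
      by (rule Cons.IH) (use Cons.prems in simp)
    moreover have "foldr (\<circ>) (f # fs) id = f \<circ> foldr (\<circ>) fs id" for f :: "nat \<Rightarrow> nat" and fs
      by simp
    ultimately show ?case using permutes_compose[OF _ x] by (simp only: list.map)
  qed (simp add: permutes_id)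
  have sub: "set (concat cs) \<subseteq> {1..n}" unfolding concat_cs by auto
  have "length cs = n div r" "\<forall>c\<in>set cs. length c = r"
    using False by (auto simp: cs_def n)
  moreover have "distinct (concat cs)" unfolding concat_cs by simp
  ultimately have "foldr (\<circ>) (map cycle_of_list cs) id \<in> cyc_perms n r"
    unfolding cyc_perms_def perms_upto_def using sub permutes[OF sub] by blast
  then show ?thesis by blast
qed

definition cayley_hypergraph ::
  "nat \<Rightarrow> nat \<Rightarrow> nat \<Rightarrow> (nat \<Rightarrow> nat \<Rightarrow> nat) \<Rightarrow> (nat \<Rightarrow> nat) hypergraph" where
  "cayley_hypergraph n r d \<tau> =
     (perms_upto n, {(\<lambda>k. \<sigma> \<circ> (\<tau> i ^^ k)) ` {..<r} |\<sigma> i. \<sigma> \<in> perms_upto n \<and> i \<in> {1..d}})"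

text \<open>The law of \<open>d\<close> independent uniform elements of \<^term>\<open>cyc_perms n r\<close>, indexed by
  \<open>{1..d}\<close> and with dummy value \<^term>\<open>id\<close> elsewhere; only meaningful when \<open>r\<close> divides \<open>n\<close>.\<close>

definition random_perms :: "nat \<Rightarrow> nat \<Rightarrow> nat \<Rightarrow> (nat \<Rightarrow> nat \<Rightarrow> nat) pmf" where
  "random_perms n r d = Pi_pmf {1..d} id (\<lambda>_. pmf_of_set (cyc_perms n r))"

end

theory Submission
  imports Defs "HOL-Real_Asymp.Real_Asymp"
begin

text \<open>A Berge cycle of length \<open>l\<close> gives a word \<open>\<tau>\<^bsub>i\<^sub>1\<^esub>\<^bsup>m\<^sub>1\<^esup> \<dots> \<tau>\<^bsub>i\<^sub>l\<^esub>\<^bsup>m\<^sub>l\<^esup>\<close> that evaluates to the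
  identity, with \<open>0 < m\<^sub>j < r\<close> and consecutive indices distinct. Fix such a word and follow the
  trajectories of fresh starting points one after another, exposing at each step only the cycle
  that is used. As long as at most about \<open>n/(2l)\<close> points have been seen, a step runs into one of
  them with conditional probability at most \<open>1/(2l)\<close>, so each trajectory closes up with
  conditional probability at most \<open>1/2\<close>. There is room for about \<open>n/(l\<^sup>2r)\<close> trajectories, hence
  the word is trivial with probability \<open>exp (-\<Omega>(n/(l\<^sup>2r)))\<close>. This beats the at most \<open>(dr)\<^sup>l\<close>
  words of length \<open>l\<close> as long as \<open>l\<^sup>3\<close> is at most a small multiple of \<open>n/(r log ((d-1)(r-1)))\<close>.\<close>

section \<open>Permutations with all cycles of the same length\<close>

lemma foldr_comp_Cons: "foldr (\<circ>) (f # fs) id = f \<circ> foldr (\<circ>) fs id"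
  by simp

lemma foldr_cycles_outside:
  assumes "x \<notin> set (concat cs)"
  shows "foldr (\<circ>) (map cycle_of_list cs) id x = x"
  using assms by (induction cs) (auto simp: id_outside_supp)

lemma foldr_cycles_inside:
  assumes "distinct (concat cs)" "c \<in> set cs" "x \<in> set c"
  shows "foldr (\<circ>) (map cycle_of_list cs) id x = cycle_of_list c x"
  using assms
proof (induction cs)
  case (Cons b cs)
  show ?case
  proof (cases "x \<in> set b")
    case True
    then have "b = c"
      using Cons.prems by auto
    moreover have "x \<notin> set (concat cs)"
      using Cons.prems True by auto
    ultimately show ?thesis
      using foldr_cycles_outside[of x cs] unfolding list.map foldr_comp_Cons by simp
  next
    case False
    then have c: "c \<in> set cs"
      using Cons.prems by auto
    have "cycle_of_list c x \<in> set c"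
      using Cons.prems(3) cycle_permutes[of c] by (simp add: permutes_in_image)
    then have "cycle_of_list c x \<notin> set b"
      using Cons.prems c by auto
    moreover have "foldr (\<circ>) (map cycle_of_list cs) id x = cycle_of_list c x"
      by (rule Cons.IH) (use Cons.prems c in auto)
    ultimately show ?thesis
      unfolding list.map foldr_comp_Cons by (simp add: id_outside_supp)
  qed
qed simp

lemma cyc_perms_permutes: "p \<in> cyc_perms n r \<Longrightarrow> p permutes {1..n}"
  by (simp add: cyc_perms_def perms_upto_def)

text \<open>The \<open>n div r\<close> disjoint lists of length \<open>r\<close> have
  \<open>n\<close> entries together when \<open>r dvd n\<close>, so they cover \<open>{1..n}\<close>
  and leave no fixed point there.\<close>

lemma cyc_perms_cycle:
  assumes p: "p \<in> cyc_perms n r" and "r dvd n" and x: "x \<in> {1..n}"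
  obtains c where "length c = r" "distinct c" "x \<in> set c"
    "\<And>y. y \<in> set c \<Longrightarrow> p y = cycle_of_list c y"
proof -
  obtain cs where cs: "length cs = n div r" "\<forall>c\<in>set cs. length c = r"
     "distinct (concat cs)" "set (concat cs) \<subseteq> {1..n}"
     "p = foldr (\<circ>) (map cycle_of_list cs) id"
    using p by (auto simp: cyc_perms_def)
  have "map length cs = replicate (n div r) r"
    using cs(1,2) by (metis map_eq_conv map_replicate_const)
  then have "length (concat cs) = n"
    using \<open>r dvd n\<close> by (simp add: length_concat sum_list_replicate)
  then have "set (concat cs) = {1..n}"
    using cs(4) distinct_card[OF cs(3)] by (intro card_subset_eq) simp_all
  then obtain c where c: "c \<in> set cs" "x \<in> set c"
    using x by (metis UN_E set_concat)
  show thesis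
  proof (rule that)
    show "length c = r" "distinct c" "x \<in> set c"
      using c cs by (auto simp: distinct_concat_iff)
    show "p y = cycle_of_list c y" if "y \<in> set c" for y
      using foldr_cycles_inside[OF cs(3) c(1) that] cs(5) by simp
  qed
qed

lemma funpow_agree:
  assumes "\<And>y. y \<in> S \<Longrightarrow> p y = q y" "q ` S \<subseteq> S" "y \<in> S"
  shows "(p ^^ m) y = (q ^^ m) y \<and> (q ^^ m) y \<in> S"
  using assms by (induction m) auto

text \<open>On the cycle through \<open>x\<close>, the power \<open>p ^^ m\<close> rotates the list
  by \<open>m\<close> places. In particular an exponent strictly between 0 and \<open>r\<close>
  moves every point of \<open>{1..n}\<close>.\<close>

lemma cyc_perms_funpow_eq_iff:
  assumes "p \<in> cyc_perms n r" "r dvd n" "x \<in> {1..n}"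
  shows "(p ^^ m) x = x \<longleftrightarrow> r dvd m"
proof -
  obtain c where c: "length c = r" "distinct c" "x \<in> set c"
      "\<And>y. y \<in> set c \<Longrightarrow> p y = cycle_of_list c y"
    using cyc_perms_cycle[OF assms] by blast
  obtain a where a: "a < r" "x = c ! a"
    using c by (metis in_set_conv_nth)
  have "(p ^^ m) x = (cycle_of_list c ^^ m) x"
    using funpow_agree[of "set c" p "cycle_of_list c" x m] c
    by (simp add: cycle_is_surj)
  also have "\<dots> = map (cycle_of_list c ^^ m) c ! a"
    using a c by simp
  also have "\<dots> = c ! ((m + a) mod r)"
    unfolding cyclic_rotation[OF c(2)] using a c(1) by (simp add: nth_rotate)
  also have "\<dots> = x \<longleftrightarrow> (m + a) mod r = a"
    using a c by (simp add: nth_eq_iff_index_eq)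
  also have "\<dots> \<longleftrightarrow> r dvd m"
    using a(1) mod_eq_dvd_iff_nat[of a "m + a" r] by simp
  finally show ?thesis .
qed

lemma cyc_perms_funpow_id:
  assumes "p \<in> cyc_perms n r" "r dvd n"
  shows "p ^^ r = id"
proof
  fix x
  show "(p ^^ r) x = id x"
  proof (cases "x \<in> {1..n}")
    case False
    then show ?thesis
      using permutes_funpow[OF cyc_perms_permutes[OF assms(1)], of r]
      by (simp add: permutes_not_in)
  qed (use cyc_perms_funpow_eq_iff[OF assms] in simp)
qed

section \<open>Closure under conjugation\<close>

lemma foldr_comp_conjugate:
  assumes "inv t \<circ> t = id" "t \<circ> inv t = id"
  shows "t \<circ> foldr (\<circ>) fs id \<circ> inv t = foldr (\<circ>) (map (\<lambda>f. t \<circ> f \<circ> inv t) fs) id"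
proof (induction fs)
  case (Cons f fs)
  have "t \<circ> (f \<circ> g) \<circ> inv t = (t \<circ> f \<circ> inv t) \<circ> (t \<circ> g \<circ> inv t)" for g
    using assms(1) by (simp add: fun_eq_iff)
  then show ?case
    unfolding foldr_comp_Cons list.map Cons.IH[symmetric] by blast
qed (use assms in simp)

text \<open>Conjugating by \<open>t\<close> relabels the entries of every cycle by \<open>t\<close>.
  This symmetry is the source of all uniformity used later.\<close>

lemma cyc_perms_conjugate:
  assumes p: "p \<in> cyc_perms n r" and t: "t permutes {1..n}"
  shows "t \<circ> p \<circ> inv t \<in> cyc_perms n r"
proof -
  obtain cs where cs: "length cs = n div r" "\<forall>c\<in>set cs. length c = r"
     "distinct (concat cs)" "set (concat cs) \<subseteq> {1..n}"
     "p = foldr (\<circ>) (map cycle_of_list cs) id"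
    using p by (auto simp: cyc_perms_def)
  have "bij t"
    using t by (rule permutes_bij)
  have "t \<circ> p \<circ> inv t = foldr (\<circ>) (map cycle_of_list (map (map t) cs)) id"
  proof -
    have "t \<circ> cycle_of_list c \<circ> inv t = cycle_of_list (map t c)" if "c \<in> set cs" for c
      using conjugation_of_cycle[OF _ \<open>bij t\<close>] that cs(3) by (simp add: distinct_concat_iff)
    then have "map (\<lambda>f. t \<circ> f \<circ> inv t) (map cycle_of_list cs) = map cycle_of_list (map (map t) cs)"
      by simp
    then show ?thesis
      using foldr_comp_conjugate[of t "map cycle_of_list cs"] \<open>bij t\<close> cs(5)
      by (metis bij_is_inj bij_is_surj inv_o_cancel surj_iff)
  qed
  moreover have "distinct (concat (map (map t) cs))"
    unfolding map_concat[symmetric]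
    using cs(3) inj_on_subset[OF bij_is_inj[OF \<open>bij t\<close>] subset_UNIV] by (simp only: distinct_map)
  moreover have "set (concat (map (map t) cs)) \<subseteq> {1..n}"
    unfolding map_concat[symmetric]
    using cs(4) permutes_image[OF t] by (metis image_mono set_map)
  moreover have "t \<circ> p \<circ> inv t permutes {1..n}"
    using cyc_perms_permutes[OF p] t by (intro permutes_compose permutes_inv)
  ultimately show ?thesis
    unfolding cyc_perms_def perms_upto_def mem_Collect_eq
    using cs(1,2) by (intro conjI exI[of _ "map (map t) cs"]) simp_all
qed

section \<open>Exposing cycles one at a time\<close>

text \<open>The support of \<open>random_perms\<close>, with the same dummy value \<open>id\<close>;
  when \<open>r dvd n\<close> the law is uniform on it, so probabilities become ratios of
  cardinalities.\<close>

definition perm_tuples :: "nat \<Rightarrow> nat \<Rightarrow> nat \<Rightarrow> (nat \<Rightarrow> nat \<Rightarrow> nat) set" where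
  "perm_tuples n r d = PiE_dflt {1..d} id (\<lambda>_. cyc_perms n r)"

text \<open>The event conditioned on: agreement with all revealed values. Conditional probabilities
  are counts relative to this set.\<close>

definition consistent ::
  "nat \<Rightarrow> nat \<Rightarrow> nat \<Rightarrow> (nat \<Rightarrow> nat set) \<Rightarrow> (nat \<Rightarrow> nat \<Rightarrow> nat) \<Rightarrow> (nat \<Rightarrow> nat \<Rightarrow> nat) set" where
  "consistent n r d E \<tau>\<^sub>0 = {\<tau> \<in> perm_tuples n r d. \<forall>i. \<forall>x\<in>E i. \<tau> i x = \<tau>\<^sub>0 i x}"

text \<open>A stage of the exposure: \<^term>\<open>\<tau>\<^sub>0 i\<close> has been revealed exactly on \<^term>\<open>E i\<close>, a union of
  its cycles, and \<^term>\<open>S\<close> contains every point seen so far.\<close>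

definition exposure ::
  "nat \<Rightarrow> nat \<Rightarrow> nat \<Rightarrow> (nat \<Rightarrow> nat set) \<Rightarrow> nat set \<Rightarrow> (nat \<Rightarrow> nat \<Rightarrow> nat) \<Rightarrow> bool" where
  "exposure n r d E S \<tau>\<^sub>0 \<longleftrightarrow> \<tau>\<^sub>0 \<in> perm_tuples n r d \<and> S \<subseteq> {1..n} \<and>
     (\<forall>i. E i \<subseteq> S \<and> \<tau>\<^sub>0 i ` E i \<subseteq> E i)"

text \<open>A whole orbit is revealed, not a single value, so that the exposed set stays closed
  under the permutation.\<close>

definition expose_orbit ::
  "(nat \<Rightarrow> nat set) \<Rightarrow> nat \<Rightarrow> nat \<Rightarrow> (nat \<Rightarrow> nat \<Rightarrow> nat) \<Rightarrow> nat \<Rightarrow> nat set" where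
  "expose_orbit E i y \<tau> = E(i := E i \<union> range (\<lambda>k. (\<tau> i ^^ k) y))"

lemma finite_perm_tuples: "finite (perm_tuples n r d)"
  unfolding perm_tuples_def by (intro finite_PiE_dflt) (auto simp: finite_cyc_perms)

lemma finite_consistent: "finite (consistent n r d E \<tau>)"
  by (simp add: consistent_def finite_perm_tuples)

lemma perm_tuplesD: "\<tau> \<in> perm_tuples n r d \<Longrightarrow> i \<in> {1..d} \<Longrightarrow> \<tau> i \<in> cyc_perms n r"
  by (auto simp: perm_tuples_def PiE_dflt_def)

lemma consistent_funpow:
  assumes "exposure n r d E S \<tau>\<^sub>0" "\<tau> \<in> consistent n r d E \<tau>\<^sub>0" "x \<in> E i"
  shows "(\<tau> i ^^ k) x \<in> E i"
proof -
  have "\<tau>\<^sub>0 i ` E i \<subseteq> E i"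
    using assms(1) by (auto simp: exposure_def)
  then show ?thesis
    using funpow_agree[of "E i" "\<tau> i" "\<tau>\<^sub>0 i" x k] assms(2,3) by (simp add: consistent_def)
qed

text \<open>The transposition fixes \<open>E i\<close> pointwise and \<open>\<tau> i\<close> maps
  \<open>E i\<close> into itself, so no revealed value changes.\<close>

lemma consistent_conjugate:
  assumes \<tau>: "\<tau> \<in> consistent n r d E \<tau>\<^sub>0" and ex: "exposure n r d E S \<tau>\<^sub>0" and i: "i \<in> {1..d}"
    and z: "z \<in> {1..n} - E i" "z' \<in> {1..n} - E i"
  shows "\<tau>(i := Transposition.transpose z z' \<circ> \<tau> i \<circ> Transposition.transpose z z')
    \<in> consistent n r d E \<tau>\<^sub>0"
proof -
  let ?t = "Transposition.transpose z z'"
  have "?t permutes {1..n}"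
    using z by (intro permutes_swap_id) auto
  then have "?t \<circ> \<tau> i \<circ> ?t \<in> cyc_perms n r"
    using cyc_perms_conjugate[of "\<tau> i" n r ?t] perm_tuplesD[of \<tau> n r d i] \<tau> i
    by (simp add: consistent_def)
  then have "\<tau>(i := ?t \<circ> \<tau> i \<circ> ?t) \<in> perm_tuples n r d"
    using \<tau> i by (auto simp: consistent_def perm_tuples_def PiE_dflt_def)
  moreover have "?t (\<tau> i (?t x)) = \<tau>\<^sub>0 i x" if "x \<in> E i" for x
  proof -
    have "\<tau> i x = \<tau>\<^sub>0 i x" "\<tau>\<^sub>0 i x \<in> E i"
      using that \<tau> ex unfolding consistent_def exposure_def by blast+
    then show ?thesis
      using that z by (auto simp: Transposition.transpose_def)
  qed
  ultimately show ?thesis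
    using \<tau> by (auto simp: consistent_def)
qed

lemma conjugate_funpow:
  assumes "t \<circ> t = id"
  shows "(t \<circ> p \<circ> t) ^^ m = t \<circ> (p ^^ m) \<circ> t"
  using assms by (induction m) (auto simp: fun_eq_iff)

text \<open>Conjugating \<^term>\<open>\<tau> i\<close> by transpositions of unexposed points shows that, given the exposed
  part, the image of \<^term>\<open>y\<close> under a power of \<^term>\<open>\<tau> i\<close> is uniform on the points outside
  \<^term>\<open>insert y (E i)\<close>.\<close>

lemma card_hit_le:
  assumes n: "r dvd n" and ex: "exposure n r d E S \<tau>\<^sub>0" and i: "i \<in> {1..d}"
    and y: "y \<in> S" "y \<notin> E i" and m: "0 < m" "m < r"
  shows "card {\<tau> \<in> consistent n r d E \<tau>\<^sub>0. (\<tau> i ^^ m) y \<in> S} * (n - card S)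
    \<le> card S * card (consistent n r d E \<tau>\<^sub>0)"
proof -
  define \<Omega> where "\<Omega> = consistent n r d E \<tau>\<^sub>0"
  define T where "T = {1..n} - insert y (E i)"
  define N where "N z = card {\<tau> \<in> \<Omega>. (\<tau> i ^^ m) y = z}" for z
  have fin: "finite \<Omega>" "finite T"
    by (simp_all add: \<Omega>_def finite_consistent T_def)
  have S: "S \<subseteq> {1..n}" "insert y (E i) \<subseteq> S"
    using ex y by (auto simp: exposure_def)
  have yn: "y \<in> {1..n}"
    using S y by blast
  \<comment> \<open>If the image lay in \<open>E i\<close>, the remaining \<open>r - m\<close>
    applications would bring it back to \<open>y\<close> without leaving the closed set
    \<open>E i\<close>.\<close>
  have T: "(\<tau> i ^^ m) y \<in> T" if "\<tau> \<in> \<Omega>" for \<tau>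
  proof -
    have p: "\<tau> i \<in> cyc_perms n r"
      using that i by (auto simp: \<Omega>_def consistent_def intro: perm_tuplesD)
    have "(\<tau> i ^^ m) y \<in> {1..n}"
      using permutes_in_image[OF permutes_funpow[OF cyc_perms_permutes[OF p]]] yn by blast
    moreover have "(\<tau> i ^^ m) y \<noteq> y"
      using cyc_perms_funpow_eq_iff[OF p n yn] m by (auto dest: dvd_imp_le)
    moreover have "(\<tau> i ^^ m) y \<notin> E i"
    proof
      assume "(\<tau> i ^^ m) y \<in> E i"
      then have "(\<tau> i ^^ (r - m)) ((\<tau> i ^^ m) y) \<in> E i"
        using consistent_funpow[OF ex] that by (simp add: \<Omega>_def)
      then have "(\<tau> i ^^ r) y \<in> E i"
        using m by (simp add: funpow_add[symmetric, THEN fun_cong, unfolded comp_apply])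
      then show False
        using cyc_perms_funpow_id[OF p n] y by simp
    qed
    ultimately show ?thesis
      by (simp add: T_def)
  qed
  \<comment> \<open>Conjugation by the transposition is an involution on tuples, and the
    transposition fixes \<open>y\<close>. Exchanging \<open>z\<close> and \<open>z'\<close> turns
    the inequality into equality.\<close>
  have N_le: "N z \<le> N z'" if z: "z \<in> T" "z' \<in> T" for z z'
    unfolding N_def
  proof (rule card_inj_on_le)
    let ?t = "Transposition.transpose z z'"
    let ?c = "\<lambda>\<tau>. \<tau>(i := ?t \<circ> \<tau> i \<circ> ?t)"
    have tt: "?t \<circ> ?t = id"
      by simp
    have "?c (?c \<tau>) = \<tau>" for \<tau>
      by (auto simp: fun_eq_iff)
    then show "inj_on ?c {\<tau> \<in> \<Omega>. (\<tau> i ^^ m) y = z}"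
      by (metis (no_types, lifting) inj_onI)
    have "?t y = y"
      using z by (auto simp: T_def Transposition.transpose_def)
    then show "?c ` {\<tau> \<in> \<Omega>. (\<tau> i ^^ m) y = z} \<subseteq> {\<tau> \<in> \<Omega>. (\<tau> i ^^ m) y = z'}"
      using consistent_conjugate[OF _ ex i, of _ z z'] z conjugate_funpow[OF tt]
      by (auto simp: \<Omega>_def T_def)
    show "finite {\<tau> \<in> \<Omega>. (\<tau> i ^^ m) y = z'}"
      using fin by simp
  qed
  have sum_N: "(\<Sum>z\<in>U. N z) = card {\<tau> \<in> \<Omega>. (\<tau> i ^^ m) y \<in> U}" if "finite U" for U
  proof -
    have "{\<tau> \<in> \<Omega>. (\<tau> i ^^ m) y \<in> U} = (\<Union>z\<in>U. {\<tau> \<in> \<Omega>. (\<tau> i ^^ m) y = z})"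
      by auto
    then show ?thesis
      unfolding N_def using that fin by (simp add: card_UN_disjoint disjoint_iff)
  qed
  have N_card: "card T * N z = card \<Omega>" if "z \<in> T" for z
  proof -
    have "card \<Omega> = (\<Sum>z'\<in>T. N z')"
      using sum_N[OF fin(2)] T by (metis (no_types, lifting) Collect_cong Collect_mem_eq)
    also have "\<dots> = (\<Sum>z'\<in>T. N z)"
      using N_le that by (intro sum.cong refl antisym) auto
    finally show ?thesis
      by simp
  qed
  have "{\<tau> \<in> \<Omega>. (\<tau> i ^^ m) y \<in> S} = {\<tau> \<in> \<Omega>. (\<tau> i ^^ m) y \<in> S \<inter> T}"
    using T by auto
  then have hit: "card {\<tau> \<in> \<Omega>. (\<tau> i ^^ m) y \<in> S} = (\<Sum>z\<in>S \<inter> T. N z)"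
    using sum_N[of "S \<inter> T"] fin(2) by simp
  have finS: "finite S"
    using S(1) finite_subset by blast
  \<comment> \<open>\<open>T\<close> contains the complement of \<open>S\<close>, because
    \<open>y\<close> and \<open>E i\<close> lie in \<open>S\<close>.\<close>
  have "n - card S \<le> card T"
  proof -
    have "card {1..n} - card S \<le> card ({1..n} - S)"
      using diff_card_le_card_Diff[OF finS] by blast
    also have "\<dots> \<le> card T"
      using S fin(2) by (intro card_mono) (auto simp: T_def)
    finally show ?thesis
      by simp
  qed
  then have "(\<Sum>z\<in>S \<inter> T. N z) * (n - card S) \<le> (\<Sum>z\<in>S \<inter> T. N z) * card T"
    by simp
  also have "\<dots> = (\<Sum>z\<in>S \<inter> T. card \<Omega>)"
    unfolding sum_distrib_right using N_card by (intro sum.cong) (auto simp: mult.commute)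
  also have "\<dots> = card (S \<inter> T) * card \<Omega>"
    by simp
  also have "\<dots> \<le> card S * card \<Omega>"
    by (intro mult_right_mono card_mono finS) auto
  finally show ?thesis
    by (simp add: hit \<Omega>_def[symmetric])
qed

section \<open>Partition of the tuples by a revealed orbit\<close>

lemma card_orbit_le:
  assumes "p \<in> cyc_perms n r" "r dvd n" "0 < r"
  shows "card (range (\<lambda>k. (p ^^ k) y)) \<le> r"
proof -
  have "range (\<lambda>k. (p ^^ k) y) \<subseteq> (\<lambda>k. (p ^^ k) y) ` {..<r}"
  proof
    fix z assume "z \<in> range (\<lambda>k. (p ^^ k) y)"
    then obtain k where "z = (p ^^ k) y"
      by blast
    also have "\<dots> = (p ^^ (k mod r)) y"
      using cyc_perms_funpow_id[OF assms(1,2)] by (simp add: funpow_mod_eq)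
    finally show "z \<in> (\<lambda>k. (p ^^ k) y) ` {..<r}"
      using assms(3) by simp
  qed
  then have "card (range (\<lambda>k. (p ^^ k) y)) \<le> card ((\<lambda>k. (p ^^ k) y) ` {..<r})"
    by (intro card_mono) auto
  also have "\<dots> \<le> r"
    using card_image_le[of "{..<r}"] by simp
  finally show ?thesis .
qed

lemma exposure_expose_orbit:
  assumes ex: "exposure n r d E S \<tau>\<^sub>0" and \<tau>: "\<tau> \<in> consistent n r d E \<tau>\<^sub>0"
    and "i \<in> {1..d}" "y \<in> {1..n}"
  shows "exposure n r d (expose_orbit E i y \<tau>) (S \<union> range (\<lambda>k. (\<tau> i ^^ k) y)) \<tau>"
proof -
  have "\<tau> i \<in> cyc_perms n r"
    using assms by (auto simp: consistent_def intro: perm_tuplesD)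
  then have "range (\<lambda>k. (\<tau> i ^^ k) y) \<subseteq> {1..n}"
    using permutes_in_image[OF permutes_funpow[OF cyc_perms_permutes]] assms(4) by blast
  moreover have "\<tau> i ((\<tau> i ^^ k) y) \<in> range (\<lambda>k. (\<tau> i ^^ k) y)" for k
    by (rule range_eqI[of _ _ "Suc k"]) simp
  moreover have "\<tau> j x \<in> E j" if "x \<in> E j" for j x
    using consistent_funpow[OF ex \<tau> that, of 1] by simp
  ultimately show ?thesis
    using ex \<tau> unfolding exposure_def expose_orbit_def consistent_def
    by (auto split: if_splits)
qed

lemma consistent_expose_orbit_subset:
  assumes "\<tau> \<in> consistent n r d E \<tau>\<^sub>0"
  shows "consistent n r d (expose_orbit E i y \<tau>) \<tau> \<subseteq> consistent n r d E \<tau>\<^sub>0"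
  using assms by (auto simp: consistent_def expose_orbit_def split: if_splits)

lemma consistent_refl: "\<tau> \<in> perm_tuples n r d \<Longrightarrow> \<tau> \<in> consistent n r d E \<tau>"
  by (simp add: consistent_def)

lemma expose_orbit_funpow:
  assumes "\<tau>' \<in> consistent n r d (expose_orbit E i y \<tau>) \<tau>"
  shows "(\<tau>' i ^^ k) y = (\<tau> i ^^ k) y"
proof -
  have "\<tau>' i x = \<tau> i x" if "x \<in> range (\<lambda>k. (\<tau> i ^^ k) y)" for x
    using that assms by (auto simp: consistent_def expose_orbit_def)
  moreover have "\<tau> i ` range (\<lambda>k. (\<tau> i ^^ k) y) \<subseteq> range (\<lambda>k. (\<tau> i ^^ k) y)"
    by (auto intro: range_eqI[of _ _ "Suc _"])
  moreover have "y \<in> range (\<lambda>k. (\<tau> i ^^ k) y)"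
    by (rule range_eqI[of _ _ 0]) simp
  ultimately show ?thesis
    using funpow_agree[of "range (\<lambda>k. (\<tau> i ^^ k) y)" "\<tau>' i" "\<tau> i" y k] by blast
qed

text \<open>Members of a class have the same orbit of \<open>y\<close> and the same revealed values,
  so each of them generates the same class: the classes form a partition.\<close>

lemma consistent_expose_orbit_eq:
  assumes "\<tau>' \<in> consistent n r d (expose_orbit E i y \<tau>) \<tau>"
  shows "consistent n r d (expose_orbit E i y \<tau>') \<tau>' = consistent n r d (expose_orbit E i y \<tau>) \<tau>"
proof -
  have E: "expose_orbit E i y \<tau>' = expose_orbit E i y \<tau>"
    using expose_orbit_funpow[OF assms] by (simp add: expose_orbit_def)
  have "\<tau>' j x = \<tau> j x" if "x \<in> expose_orbit E i y \<tau> j" for j x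
    using that assms by (auto simp: consistent_def)
  then show ?thesis
    unfolding E by (simp add: consistent_def)
qed

text \<open>The law of total probability in counting form: \<open>cls\<close> gives a partition of
  \<open>\<Omega>\<close>, and \<open>b\<close>, constant on each block, bounds the conditional
  probability of \<open>A\<close> there.\<close>

lemma card_Int_le_sum_classes:
  fixes b :: "'a \<Rightarrow> real"
  assumes "finite \<Omega>"
    and refl: "\<And>t. t \<in> \<Omega> \<Longrightarrow> t \<in> cls t"
    and sub: "\<And>t. t \<in> \<Omega> \<Longrightarrow> cls t \<subseteq> \<Omega>"
    and cls: "\<And>t u. t \<in> \<Omega> \<Longrightarrow> u \<in> cls t \<Longrightarrow> cls u = cls t"
    and b: "\<And>t u. t \<in> \<Omega> \<Longrightarrow> u \<in> cls t \<Longrightarrow> b u = b t"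
    and le: "\<And>t. t \<in> \<Omega> \<Longrightarrow> card (A \<inter> cls t) \<le> b t * card (cls t)"
  shows "card (A \<inter> \<Omega>) \<le> (\<Sum>t\<in>\<Omega>. b t)"
proof -
  have fib: "{u \<in> \<Omega>. cls u = cls t} = cls t" if "t \<in> \<Omega>" for t
    using that refl sub cls by blast
  have "real (card (A \<inter> \<Omega>)) = (\<Sum>t\<in>\<Omega>. if t \<in> A then 1 else 0)"
    using assms(1) by (simp add: sum.If_cases Int_commute)
  also have "\<dots> = (\<Sum>c\<in>cls ` \<Omega>. \<Sum>t\<in>{u \<in> \<Omega>. cls u = c}. if t \<in> A then 1 else 0)"
    by (rule sum.group[symmetric]) (use assms(1) in auto)
  also have "\<dots> \<le> (\<Sum>c\<in>cls ` \<Omega>. \<Sum>t\<in>{u \<in> \<Omega>. cls u = c}. b t)"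
  proof (rule sum_mono)
    fix c assume "c \<in> cls ` \<Omega>"
    then obtain t where t: "t \<in> \<Omega>" "c = cls t"
      by blast
    have "finite (cls t)"
      using sub[OF t(1)] assms(1) finite_subset by blast
    then have "(\<Sum>t\<in>cls t. if t \<in> A then 1 else 0) = real (card (A \<inter> cls t))"
      by (simp add: sum.If_cases Int_commute)
    also have "\<dots> \<le> (\<Sum>u\<in>cls t. b u)"
      using le[OF t(1)] b[OF t(1)] by (simp add: mult.commute)
    finally show "(\<Sum>t\<in>{u \<in> \<Omega>. cls u = c}. if t \<in> A then 1 else 0) \<le> (\<Sum>t\<in>{u \<in> \<Omega>. cls u = c}. b t)"
      using fib t by simp
  qed
  also have "\<dots> = (\<Sum>t\<in>\<Omega>. b t)"
    by (rule sum.group) (use assms(1) in auto)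
  finally show ?thesis .
qed

section \<open>Trivial words\<close>

text \<open>The head of the list acts first, so the word is read in the opposite order to
  composition.\<close>

fun walk :: "(nat \<Rightarrow> nat \<Rightarrow> nat) \<Rightarrow> (nat \<times> nat) list \<Rightarrow> nat \<Rightarrow> nat" where
  "walk \<tau> [] x = x"
| "walk \<tau> ((i, m) # w) x = walk \<tau> w ((\<tau> i ^^ m) x)"

text \<open>Reducedness is not cyclic: the first and the last letter may have the same index.\<close>

definition reduced_word :: "nat \<Rightarrow> nat \<Rightarrow> (nat \<times> nat) list \<Rightarrow> bool" where
  "reduced_word r d w \<longleftrightarrow> distinct_adj (map fst w) \<and> set w \<subseteq> {1..d} \<times> {1..<r}"

lemma reduced_word_Cons:
  "reduced_word r d (a # w) \<longleftrightarrow> fst a \<in> {1..d} \<and> snd a \<in> {1..<r} \<and> reduced_word r d w \<and>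
     (w \<noteq> [] \<longrightarrow> fst a \<noteq> fst (hd w))"
  by (cases a; cases w) (auto simp: reduced_word_def)

text \<open>A walk ending at the old point \<^term>\<open>x\<close> must hit \<^term>\<open>S\<close> at some step. Up to its first hit,
  the current point is new, so its cycle under the next letter is still unexposed, and each step
  hits with conditional probability at most \<^term>\<open>s\<close>. After a hit, the hypothesis on \<^term>\<open>A\<close>
  gives the factor \<^term>\<open>c\<close>; this lets different starting points be treated one after another.\<close>

lemma card_walk_eq_le:
  fixes c s :: real
  assumes n: "r dvd n" and c: "0 \<le> c" and s: "0 \<le> s" "real M \<le> s * (real n - real M)"
    and A: "\<And>E S \<tau>\<^sub>0. exposure n r d E S \<tau>\<^sub>0 \<Longrightarrow> card S \<le> M \<Longrightarrow>
      card (A \<inter> consistent n r d E \<tau>\<^sub>0) \<le> c * card (consistent n r d E \<tau>\<^sub>0)"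
    and "exposure n r d E S \<tau>\<^sub>0" "reduced_word r d w" "x \<in> S" "y \<in> S"
    and "w = [] \<longrightarrow> y \<noteq> x" "w \<noteq> [] \<longrightarrow> y \<notin> E (fst (hd w))"
    and "card S + length w * r \<le> M"
  shows "card ({\<tau> \<in> A. walk \<tau> w y = x} \<inter> consistent n r d E \<tau>\<^sub>0)
    \<le> length w * s * c * card (consistent n r d E \<tau>\<^sub>0)"
  using assms(6-)
proof (induction w arbitrary: E S \<tau>\<^sub>0 y)
  case (Cons a w)
  obtain i m where a: "a = (i, m)"
    by (cases a)
  note ex = Cons.prems(1)
  have i: "i \<in> {1..d}" and m: "0 < m" "m < r" and w: "reduced_word r d w"
    and adj: "w \<noteq> [] \<longrightarrow> i \<noteq> fst (hd w)"
    using Cons.prems(2) by (auto simp: reduced_word_Cons a)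
  have y: "y \<in> S" "y \<notin> E i"
    using Cons.prems by (simp_all add: a)
  have S: "S \<subseteq> {1..n}" "finite S"
    using ex by (auto simp: exposure_def intro: finite_subset)
  have yn: "y \<in> {1..n}"
    using y S by blast
  define \<Omega> where "\<Omega> = consistent n r d E \<tau>\<^sub>0"
  define cls where "cls \<tau> = consistent n r d (expose_orbit E i y \<tau>) \<tau>" for \<tau>
  define z where "z \<tau> = (\<tau> i ^^ m) y" for \<tau> :: "nat \<Rightarrow> nat \<Rightarrow> nat"
  \<comment> \<open>The conditional bound once the orbit of \<open>y\<close> is known:
    \<open>c\<close> after a hit, the induction hypothesis for the remaining word otherwise.\<close>
  define b where "b \<tau> = (if z \<tau> \<in> S then c else length w * s * c)" for \<tau>
  define B where "B = {\<tau> \<in> A. walk \<tau> (a # w) y = x}"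
  have fin: "finite \<Omega>"
    by (simp add: \<Omega>_def finite_consistent)
  have cls_z: "z \<tau>' = z \<tau>" if "\<tau>' \<in> cls \<tau>" for \<tau> \<tau>'
    using expose_orbit_funpow that by (simp add: cls_def z_def)
  have "card (B \<inter> \<Omega>) \<le> (\<Sum>\<tau>\<in>\<Omega>. b \<tau>)"
  proof (rule card_Int_le_sum_classes[OF fin, where cls = cls])
    fix \<tau> assume \<tau>: "\<tau> \<in> \<Omega>"
    then have \<tau>': "\<tau> \<in> perm_tuples n r d"
      by (simp add: \<Omega>_def consistent_def)
    show "\<tau> \<in> cls \<tau>"
      using \<tau>' by (simp add: cls_def consistent_refl)
    show "cls \<tau> \<subseteq> \<Omega>"
      using consistent_expose_orbit_subset \<tau> by (simp add: cls_def \<Omega>_def)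
    define S' where "S' = S \<union> range (\<lambda>k. (\<tau> i ^^ k) y)"
    have ex': "exposure n r d (expose_orbit E i y \<tau>) S' \<tau>"
      unfolding S'_def using exposure_expose_orbit[OF ex _ i yn] \<tau> by (simp add: \<Omega>_def)
    have "card S' \<le> card S + r"
      unfolding S'_def using card_Un_le[of S "range (\<lambda>k. (\<tau> i ^^ k) y)"]
        card_orbit_le[OF perm_tuplesD[OF \<tau>' i] n, of y] m by simp
    then have card_S': "card S' + length w * r \<le> M"
      using Cons.prems(7) by simp
    show "real (card (B \<inter> cls \<tau>)) \<le> b \<tau> * real (card (cls \<tau>))"
    proof (cases "z \<tau> \<in> S")
      case True
      have "card (B \<inter> cls \<tau>) \<le> card (A \<inter> cls \<tau>)"
        by (intro card_mono) (auto simp: B_def cls_def finite_consistent)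
      also have "\<dots> \<le> c * card (cls \<tau>)"
        using A[OF ex'] card_S' by (simp add: cls_def)
      finally show ?thesis
        using True by (simp add: b_def)
    next
      case False
      have "B \<inter> cls \<tau> = {\<tau>' \<in> A. walk \<tau>' w (z \<tau>) = x} \<inter> cls \<tau>"
        using cls_z by (auto simp: B_def a z_def)
      also have "real (card \<dots>) \<le> length w * s * c * card (cls \<tau>)"
        unfolding cls_def
      proof (rule Cons.IH[OF ex' w])
        show "x \<in> S'" "z \<tau> \<in> S'"
          using Cons.prems(3) by (auto simp: S'_def z_def)
        show "w = [] \<longrightarrow> z \<tau> \<noteq> x"
          using False Cons.prems(3) by auto
        \<comment> \<open>The next letter has an index different from \<open>i\<close>, so its
          exposed set has not grown and still lies in \<open>S\<close>, which the new point
          avoids.\<close>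
        have "E (fst (hd w)) \<subseteq> S"
          using ex by (auto simp: exposure_def)
        then show "w \<noteq> [] \<longrightarrow> z \<tau> \<notin> expose_orbit E i y \<tau> (fst (hd w))"
          using adj False by (auto simp: expose_orbit_def)
      qed (rule card_S')
      finally show ?thesis
        using False by (simp add: b_def)
    qed
  next
    fix \<tau> \<tau>' assume "\<tau>' \<in> cls \<tau>"
    then show "cls \<tau>' = cls \<tau>" "b \<tau>' = b \<tau>"
      using consistent_expose_orbit_eq cls_z[of \<tau>' \<tau>] by (simp_all add: cls_def b_def)
  qed
  also have "\<dots> \<le> (\<Sum>\<tau>\<in>\<Omega>. (if z \<tau> \<in> S then c else 0) + length w * s * c)"
    using c s by (intro sum_mono) (auto simp: b_def)
  also have "\<dots> = c * card {\<tau> \<in> \<Omega>. z \<tau> \<in> S} + length w * s * c * card \<Omega>"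
    using fin by (simp add: sum.distrib sum.If_cases Int_def mult.commute)
  \<comment> \<open>By \<open>card_hit_le\<close> the proportion of hits is at most
    \<open>card S / (n - card S)\<close>, hence at most \<open>M / (n - M)\<close> and so at most
    \<open>s\<close>. The first letter thus adds one more term \<open>s * c\<close>.\<close>
  also have "\<dots> \<le> c * (s * card \<Omega>) + length w * s * c * card \<Omega>"
  proof (intro add_right_mono mult_left_mono c)
    \<comment> \<open>Since \<open>y \<in> S\<close>, \<open>M\<close> is positive, and the
      assumption on \<open>s\<close> then forces \<open>M < n\<close>; this makes the division by
      \<open>n - card S\<close> legitimate.\<close>
    have "0 < card S"
      using y S card_gt_0_iff by blast
    then have "0 < real M" "card S \<le> M"
      using Cons.prems(7) by auto
    then have "0 < s * (real n - real M)"
      using s by linarith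
    then have "M < n"
      using s(1) by (simp add: zero_less_mult_iff)
    then have pos: "0 < real (n - card S)"
      using \<open>card S \<le> M\<close> by simp
    have "real (card {\<tau> \<in> \<Omega>. z \<tau> \<in> S} * (n - card S)) \<le> real (card S * card \<Omega>)"
      using card_hit_le[OF n ex i y m] unfolding of_nat_le_iff by (simp add: \<Omega>_def z_def)
    also have "\<dots> \<le> s * (real n - real M) * card \<Omega>"
      using \<open>card S \<le> M\<close> s by (simp add: mult_right_mono)
    also have "\<dots> \<le> s * real (n - card S) * card \<Omega>"
      using \<open>card S \<le> M\<close> \<open>M < n\<close> s(1) by (intro mult_right_mono mult_left_mono) auto
    finally show "card {\<tau> \<in> \<Omega>. z \<tau> \<in> S} \<le> s * card \<Omega>"
      using pos by (simp add: mult.commute mult.left_commute)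
  qed
  also have "\<dots> = length (a # w) * s * c * card \<Omega>"
    by (simp add: algebra_simps)
  finally show ?case
    by (simp add: B_def \<Omega>_def)
\<comment> \<open>For the empty word the walk stays at \<open>y\<close>, which differs from
  \<open>x\<close>, so the set is empty.\<close>
qed simp

text \<open>Each of the \<open>k\<close> rounds starts at a fresh point and sees at most
  \<open>length w * r + 1\<close> new points: the start and one cycle per letter. Closing up costs a
  factor \<open>length w * s\<close> with \<open>s = 1 / (2 * length w)\<close>, that is, one
  half.\<close>

lemma card_walk_trivial_consistent_le:
  assumes n: "r dvd n" and w: "reduced_word r d w" "w \<noteq> []"
    and M: "M * (2 * length w + 1) \<le> n" and "exposure n r d E S \<tau>\<^sub>0"
    and "card S + k * (length w * r + 1) \<le> M"
  shows "card ({\<tau>. \<forall>x\<in>{1..n}. walk \<tau> w x = x} \<inter> consistent n r d E \<tau>\<^sub>0)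
    \<le> (1 / 2) ^ k * card (consistent n r d E \<tau>\<^sub>0)"
  using assms(5-)
proof (induction k arbitrary: E S \<tau>\<^sub>0)
  case 0
  show ?case
    by (simp add: card_mono finite_consistent)
next
  case (Suc k)
  let ?A = "{\<tau>. \<forall>x\<in>{1..n}. walk \<tau> w x = x}"
  let ?l = "length w"
  \<comment> \<open>Room for the \<open>k\<close> later rounds is reserved, so the induction
    hypothesis applies wherever the present walk first hits.\<close>
  define M' where "M' = M - k * (?l * r + 1)"
  have S: "S \<subseteq> {1..n}" "finite S"
    using Suc.prems by (auto simp: exposure_def intro: finite_subset)
  have "card S < M"
    using Suc.prems(2) by simp
  also have "M \<le> n"
    using M by simp
  finally have "card S < card {1..n}"
    by simp
  then obtain x where x: "x \<in> {1..n}" "x \<notin> S"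
    by (metis S(2) card_mono leD subsetI)
  have ex: "exposure n r d E (insert x S) \<tau>\<^sub>0"
    using Suc.prems(1) x by (auto simp: exposure_def)
  have "card ({\<tau> \<in> ?A. walk \<tau> w x = x} \<inter> consistent n r d E \<tau>\<^sub>0)
      \<le> ?l * (1 / (2 * ?l)) * (1 / 2) ^ k * card (consistent n r d E \<tau>\<^sub>0)"
  proof (rule card_walk_eq_le[where M = M'])
    \<comment> \<open>This is the condition \<open>M' \<le> s * (n - M')\<close> for
      \<open>s = 1 / (2 * ?l)\<close>, cleared of denominators.\<close>
    have "real (M' * (2 * ?l + 1)) \<le> real n"
      unfolding of_nat_le_iff M'_def using M by (meson diff_le_self le_trans mult_le_mono1)
    then show "real M' \<le> 1 / (2 * ?l) * (real n - real M')"
      using w(2) by (simp add: field_simps)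
    show "exposure n r d E (insert x S) \<tau>\<^sub>0" "x \<in> insert x S" "x \<in> insert x S"
      using ex by auto
    show "w \<noteq> [] \<longrightarrow> x \<notin> E (fst (hd w))"
      using Suc.prems(1) x by (auto simp: exposure_def)
    show "card (insert x S) + length w * r \<le> M'"
      using Suc.prems(2) S x by (simp add: M'_def)
    show "card (?A \<inter> consistent n r d E \<tau>\<^sub>0) \<le> (1 / 2) ^ k * card (consistent n r d E \<tau>\<^sub>0)"
      if "exposure n r d E S \<tau>\<^sub>0" "card S \<le> M'" for E S \<tau>\<^sub>0
      using that Suc.prems(2) by (intro Suc.IH[of E S]) (auto simp: M'_def)
  qed (use n w in auto)
  moreover have "{\<tau> \<in> ?A. walk \<tau> w x = x} = ?A"
    using x by auto
  ultimately show ?case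
    using w(2) by simp
qed

text \<open>Nothing is exposed at first; the exponent counts the rounds of
  \<open>length w * r + 1\<close> points that fit into a budget of
  \<open>n div (2 * length w + 1)\<close> points.\<close>

lemma card_walk_trivial_le:
  assumes n: "r dvd n" and w: "reduced_word r d w" "w \<noteq> []"
  shows "card {\<tau> \<in> perm_tuples n r d. \<forall>x\<in>{1..n}. walk \<tau> w x = x}
    \<le> (1 / 2) ^ (n div (2 * length w + 1) div (length w * r + 1)) * card (perm_tuples n r d)"
proof -
  have "perm_tuples n r d \<noteq> {}"
    using cyc_perms_nonempty[OF n] by (simp add: perm_tuples_def)
  then obtain \<tau>\<^sub>0 where "\<tau>\<^sub>0 \<in> perm_tuples n r d"
    by blast
  then have ex: "exposure n r d (\<lambda>_. {}) {} \<tau>\<^sub>0"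
    by (simp add: exposure_def)
  define M where "M = n div (2 * length w + 1)"
  have "M * (2 * length w + 1) \<le> n"
    unfolding M_def by (rule div_times_less_eq_dividend)
  moreover have "card {} + M div (length w * r + 1) * (length w * r + 1) \<le> M"
    using div_times_less_eq_dividend[of M "length w * r + 1"] by (simp only: card.empty add_0)
  ultimately have "card ({\<tau>. \<forall>x\<in>{1..n}. walk \<tau> w x = x} \<inter> consistent n r d (\<lambda>_. {}) \<tau>\<^sub>0)
      \<le> (1 / 2) ^ (M div (length w * r + 1)) * card (consistent n r d (\<lambda>_. {}) \<tau>\<^sub>0)"
    by (rule card_walk_trivial_consistent_le[OF n w _ ex])
  moreover have "consistent n r d (\<lambda>_. {}) \<tau>\<^sub>0 = perm_tuples n r d"
    by (simp add: consistent_def)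
  moreover have "{\<tau>. \<forall>x\<in>{1..n}. walk \<tau> w x = x} \<inter> perm_tuples n r d =
      {\<tau> \<in> perm_tuples n r d. \<forall>x\<in>{1..n}. walk \<tau> w x = x}"
    by auto
  ultimately show ?thesis
    by (simp only: M_def)
qed

section \<open>Short words and Berge cycles\<close>

lemma walk_append: "walk \<tau> (u @ v) x = walk \<tau> v (walk \<tau> u x)"
  by (induction u arbitrary: x) auto

text \<open>For \<open>0 < r\<close> and \<open>p ^^ r = id\<close> this is the left coset of the
  cyclic group generated by \<open>p\<close>.\<close>

definition coset_edge :: "nat \<Rightarrow> (nat \<Rightarrow> nat) \<Rightarrow> (nat \<Rightarrow> nat) \<Rightarrow> (nat \<Rightarrow> nat) set" where
  "coset_edge r p \<sigma> = (\<lambda>k. \<sigma> \<circ> (p ^^ k)) ` {..<r}"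

lemma edges_cayley_hypergraph:
  "edges (cayley_hypergraph n r d \<tau>) =
    {coset_edge r (\<tau> i) \<sigma> |\<sigma> i. \<sigma> \<in> perms_upto n \<and> i \<in> {1..d}}"
  by (simp add: cayley_hypergraph_def coset_edge_def)

lemma funpow_mod_id: "p ^^ r = id \<Longrightarrow> p ^^ (k mod r) = p ^^ k"
  by (rule ext, rule funpow_mod_eq) simp

lemma coset_edge_eq_range:
  assumes "p ^^ r = id" "0 < r"
  shows "coset_edge r p \<sigma> = range (\<lambda>k. \<sigma> \<circ> (p ^^ k))"
proof -
  have "\<sigma> \<circ> (p ^^ k) \<in> coset_edge r p \<sigma>" for k
    unfolding coset_edge_def
    by (rule image_eqI[of _ _ "k mod r"]) (use assms(2) funpow_mod_id[OF assms(1)] in auto)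
  then show ?thesis
    by (auto simp: coset_edge_def)
qed

lemma coset_edge_step:
  assumes "p ^^ r = id" "u \<in> coset_edge r p \<sigma>" "v \<in> coset_edge r p \<sigma>"
  obtains m where "m < r" "v = u \<circ> (p ^^ m)"
proof -
  obtain a b where ab: "a < r" "u = \<sigma> \<circ> (p ^^ a)" "b < r" "v = \<sigma> \<circ> (p ^^ b)"
    using assms by (auto simp: coset_edge_def)
  \<comment> \<open>The exponent is \<open>b - a\<close> modulo \<open>r\<close>, written without a
    possibly truncated difference.\<close>
  have "u \<circ> (p ^^ ((b + (r - a)) mod r)) = \<sigma> \<circ> (p ^^ (a + (b + (r - a))))"
    unfolding ab(2) funpow_mod_id[OF assms(1)] by (simp only: funpow_add comp_assoc)
  also have "a + (b + (r - a)) = b + r"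
    using ab by simp
  also have "\<sigma> \<circ> (p ^^ (b + r)) = v"
    unfolding funpow_add assms(1) ab by simp
  finally have eq: "u \<circ> (p ^^ ((b + (r - a)) mod r)) = v" .
  show thesis
    by (rule that[OF _ eq[symmetric]]) (use ab(1) in simp)
qed

lemma coset_edge_self: "0 < r \<Longrightarrow> \<sigma> \<in> coset_edge r p \<sigma>"
  unfolding coset_edge_def by (rule image_eqI[of _ _ 0]) auto

lemma coset_edge_eq:
  assumes "p ^^ r = id" "0 < r" "u \<in> coset_edge r p \<sigma>"
  shows "coset_edge r p u = coset_edge r p \<sigma>"
proof -
  have sub: "coset_edge r p v \<subseteq> coset_edge r p u" if "v \<in> coset_edge r p u" for u v
    using that unfolding coset_edge_eq_range[OF assms(1,2)]
    by (auto simp: comp_assoc funpow_add[symmetric])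
  obtain m where "m < r" "\<sigma> = u \<circ> (p ^^ m)"
    using coset_edge_step[OF assms(1,3) coset_edge_self[OF assms(2)]] by blast
  then have "\<sigma> \<in> coset_edge r p u"
    by (auto simp: coset_edge_def)
  then show ?thesis
    using sub assms(3) by blast
qed

section \<open>From Berge cycles to trivial words\<close>

lemma walk_of_steps:
  assumes "\<And>j. j < k \<Longrightarrow> v j = v (Suc j) \<circ> (\<tau> (a j) ^^ m j)"
  shows "v 0 x = v k (walk \<tau> (map (\<lambda>j. (a j, m j)) [0..<k]) x)"
  using assms by (induction k) (auto simp: walk_append)

text \<open>Consecutive vertices share an edge, so they differ by a nontrivial power of its
  generator. Going round once gives \<open>v 0\<close> composed with the word on one side and
  \<open>v 0\<close> on the other; injectivity cancels \<open>v 0\<close>.\<close>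

lemma reduced_word_of_berge_cycle:
  assumes n: "r dvd n" and r: "0 < r" and \<tau>: "\<tau> \<in> perm_tuples n r d"
    and C: "C \<subseteq> edges (cayley_hypergraph n r d \<tau>)" "berge_cycle l C"
  obtains w where "reduced_word r d w" "length w = l" "\<And>x. walk \<tau> w x = x"
proof -
  obtain es vs where l: "2 \<le> l" and es: "distinct es" "set es = C" "length es = l"
    and vs: "distinct vs" "length vs = l" "\<forall>i<l. vs ! i \<in> es ! i \<inter> es ! (Suc i mod l)"
    using C(2) by (auto simp: berge_cycle_def)
  \<comment> \<open>Indexing modulo \<open>l\<close> makes \<open>v l\<close> equal to
    \<open>v 0\<close> and removes the special case at the wrap-around.\<close>
  define v where "v j = vs ! (j mod l)" for j
  define e where "e j = es ! (j mod l)" for j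
  have lpos: "0 < l"
    using l by simp
  have mem: "v j \<in> e j" "v j \<in> e (Suc j)" for j
    using vs(3)[rule_format, of "j mod l"] lpos by (simp_all add: v_def e_def mod_Suc_eq)
  have neq: "j mod l \<noteq> Suc j mod l" for j
    using l by (auto simp: mod_Suc)
  have v_neq: "v j \<noteq> v (Suc j)" for j
    using neq[of j] vs(1,2) lpos by (simp add: v_def nth_eq_iff_index_eq)
  have e_neq: "e j \<noteq> e (Suc j)" for j
    using neq[of j] es(1,3) lpos by (simp add: e_def nth_eq_iff_index_eq)
  have "\<exists>i\<in>{1..d}. \<exists>\<sigma>\<in>perms_upto n. e j = coset_edge r (\<tau> i) \<sigma>" for j
  proof -
    have "e j \<in> C"
      using es lpos by (metis e_def mod_less_divisor nth_mem)
    then show ?thesis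
      using C(1) unfolding edges_cayley_hypergraph by blast
  qed
  then obtain i \<sigma> where i: "\<And>j. i j \<in> {1..d}" and \<sigma>: "\<And>j. \<sigma> j \<in> perms_upto n"
    and e: "\<And>j. e j = coset_edge r (\<tau> (i j)) (\<sigma> j)"
    by metis
  have pow: "\<tau> (i j) ^^ r = id" for j
    using cyc_perms_funpow_id[OF perm_tuplesD[OF \<tau> i] n] .
  have e_coset: "e j = coset_edge r (\<tau> (i j)) u" if "u \<in> e j" for j u
    using coset_edge_eq[OF pow r] that e by simp
  have "\<exists>m\<in>{1..<r}. v j = v (Suc j) \<circ> (\<tau> (i (Suc j)) ^^ m)" for j
  proof -
    obtain m where m: "m < r" "v j = v (Suc j) \<circ> (\<tau> (i (Suc j)) ^^ m)"
      using coset_edge_step[OF pow] mem(1)[of "Suc j"] mem(2)[of j] unfolding e by metis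
    then have "m \<noteq> 0"
      using v_neq[of j] by (intro notI) simp
    then show ?thesis
      using m by auto
  qed
  then obtain m where m: "\<And>j. m j \<in> {1..<r}" "\<And>j. v j = v (Suc j) \<circ> (\<tau> (i (Suc j)) ^^ m j)"
    by metis
  define w where "w = map (\<lambda>j. (i (Suc j), m j)) [0..<l]"
  \<comment> \<open>With equal generators, both edges would be the coset of the same group through
    \<open>v j\<close>, hence the same edge.\<close>
  have i_neq: "i j \<noteq> i (Suc j)" for j
    using e_coset[OF mem(1)[of j]] e_coset[OF mem(2)[of j]] e_neq[of j] by auto
  then have "reduced_word r d w"
    using i m(1) by (auto simp: reduced_word_def w_def distinct_adj_conv_nth)
  moreover have "walk \<tau> w x = x" for x
  proof -
    have "v 0 x = v l (walk \<tau> w x)"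
      unfolding w_def by (rule walk_of_steps) (rule m(2))
    then have "v l x = v l (walk \<tau> w x)"
      by (simp add: v_def)
    moreover have "inj (v l)"
    proof -
      have "v l \<in> coset_edge r (\<tau> (i l)) (\<sigma> l)"
        using mem e by metis
      then obtain k where "v l = \<sigma> l \<circ> (\<tau> (i l) ^^ k)"
        by (auto simp: coset_edge_def)
      moreover have "\<sigma> l permutes {1..n}" "\<tau> (i l) permutes {1..n}"
        using \<sigma>[of l] cyc_perms_permutes[OF perm_tuplesD[OF \<tau> i]] by (auto simp: perms_upto_def)
      ultimately show ?thesis
        by (metis inj_compose permutes_funpow permutes_inj)
    qed
    ultimately show ?thesis
      by (metis injD)
  qed
  ultimately show thesis
    by (intro that) (auto simp: w_def)
qed

section \<open>Uniformity, linearity and regularity of the Cayley hypergraph\<close>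

lemma coset_edge_subset_perms:
  assumes "p permutes {1..n}" "\<sigma> \<in> perms_upto n"
  shows "coset_edge r p \<sigma> \<subseteq> perms_upto n"
  using assms permutes_compose[OF permutes_funpow[OF assms(1)]]
  by (auto simp: coset_edge_def perms_upto_def)

lemma hypergraph_cayley_hypergraph:
  assumes "\<tau> \<in> perm_tuples n r d"
  shows "hypergraph (cayley_hypergraph n r d \<tau>)"
proof -
  have "coset_edge r (\<tau> i) \<sigma> \<subseteq> perms_upto n" if "\<sigma> \<in> perms_upto n" "i \<in> {1..d}" for \<sigma> i
    using coset_edge_subset_perms[OF cyc_perms_permutes[OF perm_tuplesD[OF assms]]] that by blast
  moreover have "finite (perms_upto n)"
    by (simp add: perms_upto_def finite_permutations)
  ultimately show ?thesis
    unfolding hypergraph_def edges_cayley_hypergraph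
    by (auto simp: cayley_hypergraph_def)
qed

text \<open>The powers of \<open>p\<close> are told apart by their values at the point 1, which
  exists since \<open>0 < n\<close> and is moved by every power with exponent strictly between 0 and
  \<open>r\<close>.\<close>

lemma card_coset_edge:
  assumes "r dvd n" "0 < n" "p \<in> cyc_perms n r" "\<sigma> permutes {1..n}"
  shows "card (coset_edge r p \<sigma>) = r"
proof -
  have le: "a = b" if "a \<le> b" "b < r" "\<sigma> \<circ> (p ^^ a) = \<sigma> \<circ> (p ^^ b)" for a b
  proof -
    have "(p ^^ a) 1 = (p ^^ b) 1"
      using that(3) permutes_inj[OF assms(4)] by (metis comp_apply injD)
    then have "(p ^^ (b - a)) 1 = 1"
      using funpow_diff[OF permutes_inj[OF cyc_perms_permutes[OF assms(3)]] that(1)] by blast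
    then have "r dvd b - a"
      using cyc_perms_funpow_eq_iff[OF assms(3,1), of 1] assms(2) by simp
    then show "a = b"
      using that(1,2) nat_dvd_not_less[of "b - a" r] by fastforce
  qed
  have "inj_on (\<lambda>k. \<sigma> \<circ> (p ^^ k)) {..<r}"
  proof (rule inj_onI)
    fix a b assume "a \<in> {..<r}" "b \<in> {..<r}" "\<sigma> \<circ> (p ^^ a) = \<sigma> \<circ> (p ^^ b)"
    then show "a = b"
      using le[of a b] le[of b a] by (metis lessThan_iff nat_le_linear)
  qed
  then show ?thesis
    by (simp add: coset_edge_def card_image)
qed

lemma uniform_cayley_hypergraph:
  assumes "r dvd n" "0 < n" "\<tau> \<in> perm_tuples n r d"
  shows "uniform r (cayley_hypergraph n r d \<tau>)"
proof -
  have "finite (coset_edge r p \<sigma>)" for p \<sigma>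
    by (simp add: coset_edge_def)
  moreover have "card (coset_edge r (\<tau> i) \<sigma>) = r" if "\<sigma> \<in> perms_upto n" "i \<in> {1..d}" for \<sigma> i
    using card_coset_edge[OF assms(1,2) perm_tuplesD[OF assms(3)]] that
    by (auto simp: perms_upto_def)
  ultimately show ?thesis
    unfolding uniform_def edges_cayley_hypergraph by auto
qed

text \<open>Two edges with two common vertices form a Berge cycle of length 2; uniformity supplies
  the finiteness of the intersection.\<close>

lemma linear_hypergraph_no_2_cycle:
  assumes "\<And>C. C \<subseteq> edges H \<Longrightarrow> \<not> berge_cycle 2 C" and "uniform r H"
  shows "linear_hypergraph H"
  unfolding linear_hypergraph_def
proof (intro ballI impI conjI)
  fix e f assume ef: "e \<in> edges H" "f \<in> edges H" "e \<noteq> f"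
  show fin: "finite (e \<inter> f)"
    using ef assms(2) by (auto simp: uniform_def)
  show "card (e \<inter> f) \<le> 1"
  proof (rule ccontr)
    assume "\<not> card (e \<inter> f) \<le> 1"
    then obtain u v where uv: "u \<in> e \<inter> f" "v \<in> e \<inter> f" "u \<noteq> v"
      using fin by (metis card_le_Suc0_iff_eq One_nat_def)
    have "berge_cycle 2 {e, f}"
      unfolding berge_cycle_def using uv ef(3)
      by (intro conjI exI[of _ "[e, f]"] exI[of _ "[u, v]"]) (auto simp: less_2_cases_iff)
    then show False
      using assms(1)[of "{e, f}"] ef by simp
  qed
qed

text \<open>The edges through a vertex are its cosets, one per generator. If two of them coincided,
  one generator would be a power of the other, which yields a trivial reduced word of length
  2.\<close>

lemma regular_cayley_hypergraph:
  assumes n: "r dvd n" "0 < n" and r: "2 \<le> r" and \<tau>: "\<tau> \<in> perm_tuples n r d"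
    and word: "\<And>w. reduced_word r d w \<Longrightarrow> length w = 2 \<Longrightarrow> \<exists>x. walk \<tau> w x \<noteq> x"
  shows "regular d (cayley_hypergraph n r d \<tau>)"
  unfolding regular_def
proof
  fix \<sigma> assume "\<sigma> \<in> verts (cayley_hypergraph n r d \<tau>)"
  then have \<sigma>: "\<sigma> \<in> perms_upto n"
    by (simp add: cayley_hypergraph_def)
  have r0: "0 < r"
    using r by simp
  have pow: "\<tau> i ^^ r = id" if "i \<in> {1..d}" for i
    using cyc_perms_funpow_id[OF perm_tuplesD[OF \<tau> that] n(1)] .
  have eq: "{e \<in> edges (cayley_hypergraph n r d \<tau>). \<sigma> \<in> e} = (\<lambda>i. coset_edge r (\<tau> i) \<sigma>) ` {1..d}"
  proof (intro equalityI subsetI)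
    fix e assume "e \<in> {e \<in> edges (cayley_hypergraph n r d \<tau>). \<sigma> \<in> e}"
    then obtain \<rho> i where "i \<in> {1..d}" "e = coset_edge r (\<tau> i) \<rho>" "\<sigma> \<in> e"
      unfolding edges_cayley_hypergraph by blast
    then show "e \<in> (\<lambda>i. coset_edge r (\<tau> i) \<sigma>) ` {1..d}"
      using coset_edge_eq[OF pow r0] by blast
  next
    fix e assume "e \<in> (\<lambda>i. coset_edge r (\<tau> i) \<sigma>) ` {1..d}"
    then show "e \<in> {e \<in> edges (cayley_hypergraph n r d \<tau>). \<sigma> \<in> e}"
      using \<sigma> coset_edge_self[OF r0] unfolding edges_cayley_hypergraph by blast
  qed
  have "inj_on (\<lambda>i. coset_edge r (\<tau> i) \<sigma>) {1..d}"
  proof (rule inj_onI, rule ccontr)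
    fix i j assume ij: "i \<in> {1..d}" "j \<in> {1..d}" "i \<noteq> j"
      and "coset_edge r (\<tau> i) \<sigma> = coset_edge r (\<tau> j) \<sigma>"
    moreover have "\<sigma> \<circ> \<tau> i \<in> coset_edge r (\<tau> i) \<sigma>"
      unfolding coset_edge_def by (rule image_eqI[of _ _ 1]) (use r in auto)
    ultimately obtain k where k: "k < r" "\<sigma> \<circ> \<tau> i = \<sigma> \<circ> (\<tau> j ^^ k)"
      unfolding coset_edge_def by blast
    have "inj \<sigma>"
      using \<sigma> by (auto simp: perms_upto_def permutes_inj)
    then have ik: "\<tau> i x = (\<tau> j ^^ k) x" for x
      using k(2) by (metis comp_apply injD)
    have "\<tau> i 1 \<noteq> 1"
      using cyc_perms_funpow_eq_iff[OF perm_tuplesD[OF \<tau> ij(1)] n(1), of 1 1] n(2) r by simp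
    then have "k \<noteq> 0"
      using ik[of 1] by (intro notI) simp
    \<comment> \<open>The exponent \<open>r - k\<close> inverts \<open>\<tau> j ^^ k\<close>; it is
      below \<open>r\<close> because \<open>k \<noteq> 0\<close>.\<close>
    then have "reduced_word r d [(i, 1), (j, r - k)]"
      using ij k(1) r by (auto simp: reduced_word_def)
    then obtain x where "walk \<tau> [(i, 1), (j, r - k)] x \<noteq> x"
      using word by fastforce
    moreover have "walk \<tau> [(i, 1), (j, r - k)] x = (\<tau> j ^^ (r - k + k)) x"
      using ik[of x] by (simp add: funpow_add)
    ultimately show False
      using k(1) pow[OF ij(2)] by simp
  qed
  then show "finite {e \<in> edges (cayley_hypergraph n r d \<tau>). \<sigma> \<in> e} \<and>
      card {e \<in> edges (cayley_hypergraph n r d \<tau>). \<sigma> \<in> e} = d"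
    unfolding eq by (simp add: card_image)
qed

text \<open>The deterministic half: excluding trivial reduced words of lengths 2 to \<open>L\<close>
  suffices. Length 2 already gives linearity and regularity, the other lengths the girth.\<close>

lemma cayley_hypergraph_good:
  assumes n: "r dvd n" "0 < n" and r: "2 \<le> r" and \<tau>: "\<tau> \<in> perm_tuples n r d" and L: "2 \<le> L"
    and word: "\<And>w. reduced_word r d w \<Longrightarrow> 2 \<le> length w \<Longrightarrow> length w \<le> L \<Longrightarrow> \<exists>x. walk \<tau> w x \<noteq> x"
  defines "H \<equiv> cayley_hypergraph n r d \<tau>"
  shows "hypergraph H" "linear_hypergraph H" "uniform r H" "regular d H" "enat (Suc L) \<le> girth H"
proof -
  have r0: "0 < r"
    using r by simp
  have cyc: "L < l" if C: "C \<subseteq> edges H" "berge_cycle l C" for l C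
  proof -
    obtain w where "reduced_word r d w" "length w = l" "\<And>x. walk \<tau> w x = x"
      using reduced_word_of_berge_cycle[OF n(1) r0 \<tau> C[unfolded H_def]] by blast
    moreover have "2 \<le> l"
      using C(2) by (simp add: berge_cycle_def)
    ultimately show ?thesis
      using word[of w] by force
  qed
  show "hypergraph H"
    unfolding H_def using \<tau> by (rule hypergraph_cayley_hypergraph)
  show "uniform r H"
    unfolding H_def using n \<tau> by (rule uniform_cayley_hypergraph)
  then show "linear_hypergraph H"
    using cyc[of _ 2] L by (intro linear_hypergraph_no_2_cycle) force
  show "regular d H"
    unfolding H_def using n r \<tau> word L by (intro regular_cayley_hypergraph) auto
  show "enat (Suc L) \<le> girth H"
    unfolding girth_def using cyc by (intro Inf_greatest) (auto simp: Suc_le_eq)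
qed

section \<open>Union bound over words\<close>

lemma random_perms_eq: "r dvd n \<Longrightarrow> random_perms n r d = pmf_of_set (perm_tuples n r d)"
  unfolding random_perms_def perm_tuples_def
  by (intro Pi_pmf_of_set) (simp_all add: finite_cyc_perms cyc_perms_nonempty)

definition short_words :: "nat \<Rightarrow> nat \<Rightarrow> nat \<Rightarrow> (nat \<times> nat) list set" where
  "short_words r d L = {w. reduced_word r d w \<and> 2 \<le> length w \<and> length w \<le> L}"

text \<open>All words over the \<open>d * (r - 1)\<close> letters are counted, and each of the
  \<open>L + 1\<close> lengths is charged \<open>(d * r) ^ L\<close>.\<close>

lemma short_words_card:
  assumes "0 < d" "0 < r"
  shows "finite (short_words r d L)" "card (short_words r d L) \<le> (L + 1) * (d * r) ^ L"
proof -
  let ?A = "{1..d} \<times> {1..<r}"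
  let ?U = "\<Union>l\<in>{..L}. {w. set w \<subseteq> ?A \<and> length w = l}"
  have fin: "finite ?U"
    by (intro finite_UN_I finite_lists_length_eq) auto
  have sub: "short_words r d L \<subseteq> ?U"
    by (auto simp: short_words_def reduced_word_def)
  then show "finite (short_words r d L)"
    using fin finite_subset by blast
  have "card (short_words r d L) \<le> card ?U"
    using sub fin by (rule card_mono[rotated])
  also have "\<dots> \<le> (\<Sum>l\<in>{..L}. card {w. set w \<subseteq> ?A \<and> length w = l})"
    by (intro card_UN_le) simp
  also have "\<dots> = (\<Sum>l\<in>{..L}. (d * (r - 1)) ^ l)"
    by (simp add: card_lists_length_eq card_cartesian_product)
  also have "\<dots> \<le> (\<Sum>l\<in>{..L}. (d * r) ^ L)"
  proof (rule sum_mono)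
    fix l assume "l \<in> {..L}"
    then have "(d * (r - 1)) ^ l \<le> (d * r) ^ l" "(d * r) ^ l \<le> (d * r) ^ L"
      using assms by (auto intro!: power_mono power_increasing)
    then show "(d * (r - 1)) ^ l \<le> (d * r) ^ L"
      by simp
  qed
  finally show "card (short_words r d L) \<le> (L + 1) * (d * r) ^ L"
    by simp
qed

text \<open>The factor 2 pays for rounding down, as \<open>n div a\<close> is at least
  \<open>n / a - 1\<close>.\<close>

lemma half_power_div_le:
  assumes "0 < a" "real a \<le> b"
  shows "(1 / 2 :: real) ^ (n div a) \<le> 2 * exp (- ln 2 * (real n / b))"
proof -
  have "real n / b \<le> real n / real a"
    using assms by (intro divide_left_mono) auto
  also have "\<dots> \<le> real (n div a) + 1"
    using real_of_int_floor_add_one_ge[of "real n / real a"]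
    by (simp add: floor_divide_of_nat_eq)
  finally have "ln 2 * (real n / b) \<le> ln 2 * (real (n div a) + 1)"
    by (intro mult_left_mono) auto
  then have "exp (- ln 2 * (real (n div a) + 1)) \<le> exp (- ln 2 * (real n / b))"
    by simp
  moreover have "exp (- ln 2 * (real (n div a) + 1)) = (1 / 2) ^ (n div a) / 2"
  proof -
    have "exp (- ln 2 * (real (n div a) + 1)) = exp (real (Suc (n div a)) * - ln 2)"
      by (simp add: algebra_simps)
    also have "\<dots> = exp (- ln 2) ^ Suc (n div a)"
      by (rule exp_of_nat_mult)
    also have "exp (- ln 2) = (1 / 2 :: real)"
      by (simp add: exp_minus)
    finally show ?thesis
      by simp
  qed
  ultimately show ?thesis
    by linarith
qed

text \<open>Converts the base \<open>d * r\<close> of the word count into the product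
  \<open>(d - 1) * (r - 1)\<close> of the girth bound. That product is at least 2, so its cube is at
  least 4 times itself, while \<open>d * r\<close> is at most 3 times it.\<close>

lemma mult_le_exp:
  fixes d r :: nat
  assumes "2 \<le> d" "3 \<le> r"
  shows "real (d * r) \<le> exp (3 * (ln (real d - 1) + ln (real r - 1)))"
proof -
  define x y where "x = real d - 1" and "y = real r - 1"
  have xy: "1 \<le> x" "2 \<le> y"
    using assms by (simp_all add: x_def y_def)
  have "1 * 2 \<le> x * y"
    using xy by (intro mult_mono) auto
  then have "2 * 2 \<le> (x * y) * (x * y)"
    by (intro mult_mono) auto
  have "real (d * r) = (x + 1) * (y + 1)"
    by (simp add: x_def y_def)
  also have "\<dots> \<le> (2 * x) * (3 / 2 * y)"
    using xy by (intro mult_mono) auto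
  also have "\<dots> = 3 * (x * y)"
    by simp
  also have "\<dots> \<le> (x * y) * (x * y) * (x * y)"
    using \<open>2 * 2 \<le> (x * y) * (x * y)\<close> xy by (intro mult_right_mono) auto
  also have "\<dots> = exp (ln x + ln y) ^ 3"
    using xy by (simp add: exp_add power3_eq_cube)
  also have "\<dots> = exp (3 * (ln x + ln y))"
    using exp_of_nat_mult[of 3 "ln x + ln y"] by simp
  finally show ?thesis
    by (simp add: x_def y_def)
qed

text \<open>The relation between \<^term>\<open>n\<close> and \<^term>\<open>B\<close> is the girth bound with constant \<open>1/4\<close>.\<close>

lemma prob_good_ge:
  fixes r d n :: nat and B \<Lambda> :: real
  assumes n: "r dvd n" "0 < n" and r: "3 \<le> r" and d: "2 \<le> d" and B: "2 \<le> B"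
    and \<Lambda>: "\<Lambda> = ln (real d - 1) + ln (real r - 1)" "0 < \<Lambda>"
    and nB: "real n = 64 * real r * \<Lambda> * B ^ 3"
  shows "1 - 2 * (B + 1) * exp (- \<Lambda> * B) \<le> measure_pmf.prob (random_perms n r d)
          {\<tau>. let H = cayley_hypergraph n r d \<tau> in
             hypergraph H \<and> linear_hypergraph H \<and> uniform r H \<and> regular d H \<and>
             ereal_of_enat (girth H) \<ge> ereal B}"
    (is "_ \<le> measure_pmf.prob _ ?X")
proof -
  define \<Omega> where "\<Omega> = perm_tuples n r d"
  \<comment> \<open>Excluding cycles of length at most \<open>L\<close> gives girth at least
    \<open>L + 1\<close>, which is at least \<open>B\<close>.\<close>
  define L where "L = nat \<lfloor>B\<rfloor>"
  define W where "W = short_words r d L"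
  define F where "F w = {\<tau> \<in> \<Omega>. \<forall>x\<in>{1..n}. walk \<tau> w x = x}" for w
  have L: "2 \<le> L" "real L \<le> B" "B \<le> real (Suc L)"
    using B unfolding L_def by linarith+
  have \<Omega>: "finite \<Omega>" "\<Omega> \<noteq> {}" "0 < card \<Omega>"
    using finite_perm_tuples cyc_perms_nonempty[OF n(1)]
    by (auto simp: \<Omega>_def perm_tuples_def card_gt_0_iff)
  have W: "finite W" "card W \<le> (L + 1) * (d * r) ^ L"
    unfolding W_def using short_words_card[of d r L] r d by auto
  have good: "\<Omega> - (\<Union>w\<in>W. F w) \<subseteq> \<Omega> \<inter> ?X"
  proof
    fix \<tau> assume \<tau>: "\<tau> \<in> \<Omega> - (\<Union>w\<in>W. F w)"
    have word: "\<exists>x. walk \<tau> w x \<noteq> x" if "reduced_word r d w" "2 \<le> length w" "length w \<le> L" for w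
      using that \<tau> by (auto simp: W_def F_def short_words_def)
    have \<tau>': "\<tau> \<in> perm_tuples n r d" and r2: "2 \<le> r"
      using \<tau> r by (auto simp: \<Omega>_def)
    note g = cayley_hypergraph_good[OF n r2 \<tau>' L(1) word]
    have "ereal B \<le> ereal_of_enat (enat (Suc L))"
      using L by simp
    also have "\<dots> \<le> ereal_of_enat (girth (cayley_hypergraph n r d \<tau>))"
      using g(5) by (simp only: ereal_of_enat_le_iff)
    finally show "\<tau> \<in> \<Omega> \<inter> ?X"
      using g(1-4) \<tau> by (simp add: Let_def)
  qed
  have F: "card (F w) \<le> 2 * exp (- 4 * \<Lambda> * B) * card \<Omega>" if w: "w \<in> W" for w
  proof -
    define l where "l = length w"
    have l: "reduced_word r d w" "w \<noteq> []" "2 \<le> l" "real l \<le> B"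
      using w L by (auto simp: W_def short_words_def l_def)
    have "real ((2 * l + 1) * (l * r + 1)) \<le> real ((3 * l) * (2 * l * r))"
      unfolding of_nat_le_iff using l(3) r by (intro mult_le_mono) auto
    also have "\<dots> = 6 * real r * (real l)\<^sup>2"
      by (simp add: power2_eq_square)
    also have "\<dots> \<le> 6 * real r * B\<^sup>2"
      using l(4) by (intro mult_left_mono power_mono) auto
    finally have ab: "real ((2 * l + 1) * (l * r + 1)) \<le> 6 * real r * B\<^sup>2" .
    have "card (F w) \<le> (1 / 2) ^ (n div ((2 * l + 1) * (l * r + 1))) * card \<Omega>"
      using card_walk_trivial_le[OF n(1) l(1,2)]
      unfolding F_def \<Omega>_def l_def div_mult2_eq .
    also have "\<dots> \<le> 2 * exp (- ln 2 * (real n / (6 * real r * B\<^sup>2))) * card \<Omega>"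
      using half_power_div_le[OF _ ab] by (intro mult_right_mono) auto
    \<comment> \<open>Here \<open>64 / 6 = 32 / 3\<close>. With \<open>ln 2 \<ge> 2 / 3\<close> the
      exponent becomes at least \<open>64 / 9 * \<Lambda> * B\<close>, enough for the 4
      required.\<close>
    also have "real n / (6 * real r * B\<^sup>2) = 32 / 3 * \<Lambda> * B"
      unfolding nB using B r by (simp add: field_simps power2_eq_square power3_eq_cube)
    also have "2 * exp (- ln 2 * (32 / 3 * \<Lambda> * B)) * card \<Omega> \<le> 2 * exp (- 4 * \<Lambda> * B) * card \<Omega>"
    proof -
      have "2 / 3 * (32 / 3 * (\<Lambda> * B)) \<le> ln 2 * (32 / 3 * (\<Lambda> * B))"
        using ln2_ge_two_thirds \<Lambda>(2) B by (intro mult_right_mono) auto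
      moreover have "0 \<le> B * \<Lambda>"
        using \<Lambda>(2) B by simp
      ultimately have "- ln 2 * (32 / 3 * \<Lambda> * B) \<le> - 4 * \<Lambda> * B"
        by (simp add: mult.assoc)
      then show ?thesis
        by (intro mult_right_mono mult_left_mono) auto
    qed
    finally show ?thesis .
  qed
  have "real (card (\<Union>w\<in>W. F w)) \<le> (\<Sum>w\<in>W. real (card (F w)))"
    using card_UN_le[OF W(1), of F] by (metis of_nat_le_iff of_nat_sum)
  also have "\<dots> \<le> card W * (2 * exp (- 4 * \<Lambda> * B) * card \<Omega>)"
    using sum_mono[of W "\<lambda>w. real (card (F w))", OF F] by simp
  \<comment> \<open>The number of words grows with exponent \<open>3 * \<Lambda> * B\<close>,
    against a decay with exponent \<open>4 * \<Lambda> * B\<close> for each word; a decay of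
    \<open>\<Lambda> * B\<close> remains.\<close>
  also have "\<dots> \<le> ((B + 1) * exp (3 * \<Lambda> * B)) * (2 * exp (- 4 * \<Lambda> * B) * card \<Omega>)"
  proof (rule mult_right_mono)
    have "real (d * r) ^ L \<le> exp (3 * \<Lambda>) ^ L"
      using mult_le_exp[OF d r] unfolding \<Lambda>(1) by (intro power_mono) auto
    also have "\<dots> = exp (L * (3 * \<Lambda>))"
      by (rule exp_of_nat_mult[symmetric])
    also have "\<dots> \<le> exp (B * (3 * \<Lambda>))"
      using L \<Lambda>(2) by simp
    finally have dr: "real (d * r) ^ L \<le> exp (3 * \<Lambda> * B)"
      by (simp add: mult_ac)
    have "real (card W) \<le> real ((L + 1) * (d * r) ^ L)"
      using W(2) of_nat_le_iff by blast
    also have "\<dots> = (real L + 1) * real (d * r) ^ L"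
      by (simp add: algebra_simps)
    also have "\<dots> \<le> (B + 1) * exp (3 * \<Lambda> * B)"
      using L(2) B dr by (intro mult_mono) auto
    finally show "real (card W) \<le> (B + 1) * exp (3 * \<Lambda> * B)" .
  qed auto
  also have "\<dots> = 2 * (B + 1) * (exp (3 * \<Lambda> * B) * exp (- 4 * \<Lambda> * B)) * card \<Omega>"
    by simp
  also have "exp (3 * \<Lambda> * B) * exp (- 4 * \<Lambda> * B) = exp (- \<Lambda> * B)"
    unfolding exp_add[symmetric] by (simp add: algebra_simps)
  finally have bad: "real (card (\<Union>w\<in>W. F w)) \<le> 2 * (B + 1) * exp (- \<Lambda> * B) * card \<Omega>" .
  have "(1 - 2 * (B + 1) * exp (- \<Lambda> * B)) * card \<Omega> \<le> real (card \<Omega>) - real (card (\<Union>w\<in>W. F w))"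
    using bad by (simp add: algebra_simps)
  also have "\<dots> \<le> real (card (\<Omega> - (\<Union>w\<in>W. F w)))"
    using diff_card_le_card_Diff[of "\<Union>w\<in>W. F w" \<Omega>] W(1) \<Omega>(1) by (simp add: F_def)
  also have "\<dots> \<le> real (card (\<Omega> \<inter> ?X))"
    unfolding of_nat_le_iff using good \<Omega>(1) by (intro card_mono) auto
  finally have "1 - 2 * (B + 1) * exp (- \<Lambda> * B) \<le> real (card (\<Omega> \<inter> ?X)) / real (card \<Omega>)"
    using \<Omega>(3) by (simp only: pos_le_divide_eq of_nat_0_less_iff)
  then show ?thesis
    unfolding random_perms_eq[OF n(1)] \<Omega>_def[symmetric] measure_pmf_of_set[OF \<Omega>(2,1)] .
qed

theorem theorem8:
  shows "\<exists>c0::real. c0 > 0 \<and>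
    (\<forall>r d :: nat. r \<ge> 3 \<longrightarrow> d \<ge> 2 \<longrightarrow>
      ((\<lambda>n. measure_pmf.prob (random_perms n r d)
          {\<tau>. let H = cayley_hypergraph n r d \<tau> in
             hypergraph H \<and> linear_hypergraph H \<and> uniform r H \<and> regular d H \<and>
             ereal_of_enat (girth H) \<ge>
               ereal (c0 * (real n / (real r * (ln (real d - 1) + ln (real r - 1)))) powr (1 / 3))})
        \<longlongrightarrow> 1) (inf sequentially (principal {n. r dvd n})))"
\<comment> \<open>The cube of \<open>1 / 4\<close> produces the factor 64 relating \<open>n\<close>
  to \<open>B\<close> in \<open>prob_good_ge\<close>.\<close>
proof (intro exI[of _ "1 / 4"] conjI allI impI)
  fix r d :: nat
  assume r: "3 \<le> r" and d: "2 \<le> d"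
  define \<Lambda> where "\<Lambda> = ln (real d - 1) + ln (real r - 1)"
  define B where "B n = 1 / 4 * (real n / (real r * \<Lambda>)) powr (1 / 3)" for n :: nat
  let ?F = "inf sequentially (principal {n. r dvd n})"
  \<comment> \<open>For \<open>d = 2\<close> the first logarithm vanishes, so positivity of
    \<open>\<Lambda>\<close> comes from \<open>r \<ge> 3\<close>.\<close>
  have "0 \<le> ln (real d - 1)" "0 < ln (real r - 1)"
    using r d by simp_all
  then have \<Lambda>: "0 < \<Lambda>"
    by (simp add: \<Lambda>_def)
  then have q: "0 < real r * \<Lambda>"
    using r by simp
  then have B: "filterlim B at_top sequentially"
  proof -
    have "filterlim (\<lambda>n. 1 / 4 * (real n / c) powr (1 / 3)) at_top sequentially" if "0 < c" for c :: real
      using that by real_asymp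
    then show ?thesis
      unfolding B_def using q by blast
  qed
  have "((\<lambda>x. 1 - 2 * (x + 1) * exp (- \<Lambda> * x)) \<longlongrightarrow> 1) at_top"
    using \<Lambda> by real_asymp
  then have lim: "((\<lambda>n. 1 - 2 * (B n + 1) * exp (- \<Lambda> * B n)) \<longlongrightarrow> 1) ?F"
    using filterlim_compose[OF _ B] tendsto_mono[OF inf_le1] by blast
  show "((\<lambda>n. measure_pmf.prob (random_perms n r d)
          {\<tau>. let H = cayley_hypergraph n r d \<tau> in
             hypergraph H \<and> linear_hypergraph H \<and> uniform r H \<and> regular d H \<and>
             ereal_of_enat (girth H) \<ge>
               ereal (1 / 4 * (real n / (real r * (ln (real d - 1) + ln (real r - 1)))) powr (1 / 3))})
        \<longlongrightarrow> 1) ?F"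
    unfolding \<Lambda>_def[symmetric] B_def[symmetric]
  proof (rule tendsto_sandwich[OF _ _ lim tendsto_const])
    \<comment> \<open>As \<open>B n\<close> tends to infinity, the assumption
      \<open>2 \<le> B\<close> of \<open>prob_good_ge\<close> holds for all large \<open>n\<close>;
      its lower bound tends to 1.\<close>
    have "\<forall>\<^sub>F n in sequentially. 2 \<le> B n \<and> 0 < n"
      using B eventually_gt_at_top[of "0::nat"] by (auto simp: filterlim_at_top eventually_conj_iff)
    then show "\<forall>\<^sub>F n in ?F. 1 - 2 * (B n + 1) * exp (- \<Lambda> * B n) \<le> measure_pmf.prob (random_perms n r d)
          {\<tau>. let H = cayley_hypergraph n r d \<tau> in
             hypergraph H \<and> linear_hypergraph H \<and> uniform r H \<and> regular d H \<and>
             ereal (B n) \<le> ereal_of_enat (girth H)}"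
      unfolding eventually_inf_principal
    proof eventually_elim
      case (elim n)
      have "B n ^ 3 = 1 / 64 * ((real n / (real r * \<Lambda>)) powr (1 / 3)) ^ 3"
        by (simp add: B_def power3_eq_cube)
      also have "((real n / (real r * \<Lambda>)) powr (1 / 3)) ^ 3 = real n / (real r * \<Lambda>)"
        using elim q by (simp add: powr_powr flip: powr_numeral)
      finally have B3: "B n ^ 3 = 1 / 64 * (real n / (real r * \<Lambda>))" .
      have "real r \<noteq> 0" "\<Lambda> \<noteq> 0"
        using r \<Lambda> by simp_all
      then have nB: "real n = 64 * real r * \<Lambda> * B n ^ 3"
        unfolding B3 by simp
      show ?case
      proof
        assume "n \<in> {n. r dvd n}"
        then have "r dvd n"
          by simp
        then show "1 - 2 * (B n + 1) * exp (- \<Lambda> * B n) \<le> measure_pmf.prob (random_perms n r d)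
          {\<tau>. let H = cayley_hypergraph n r d \<tau> in
             hypergraph H \<and> linear_hypergraph H \<and> uniform r H \<and> regular d H \<and>
             ereal (B n) \<le> ereal_of_enat (girth H)}"
          using elim by (intro prob_good_ge[OF _ _ r d _ \<Lambda>_def \<Lambda> nB]) simp_all
      qed
    qed
  qed (simp add: measure_pmf.prob_le_1)
qed simp

end
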